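(* For every connected graph $X$ of maximum degree $\Delta$, there exist trees $H_1,\dots,H_{\Delta+2}$ of radius $2$, and there exists a graph $G_X$ containing a $5$-subdivision of $X$ as an induced subgraph, such that each of $H_1,\dots,H_{\Delta+2}$ is an isometric subgraph of $G_X$ and $H_1,\dots,H_{\Delta+2}$ edge cover $G_X$.
   Context: Graphs are finite, simple and undirected; isomorphism issues are ignored (graphs are identified up to isomorphism where convenient). The distance $\mathrm{dist}_G(u,v)$ of two vertices $u,v$ in a connected graph $G$ is the minimum number of edges of a path connecting $u$ and $v$. A connected subgraph $H$ of a graph $G$ is isometric if $\mathrm{dist}_H(u,v)=\mathrm{dist}_G(u,v)$ for all vertices $u,v$ of $H$. A set $\mathcal{H}$ of subgraphs of $G$ edge covers $G$ if $E(G)=\bigcup_{H\in\mathcal{H}}E(H)$. Subdividing an edge $uv\in E(G)$ $c$ times means replacing the edge $uv$ by a path $u s_1 s_2\cdots s_c v$ where $s_1,\dots,s_c$ are new vertices. For a positive integer $c$, a $c$-subdivision of $G$ is a graph obtained from $G$ by subdividing each edge of $G$ $c$ times. The radius of a graph $H$ is the minimum nonnegative integer $r$ such that there is a vertex $u$ of $H$ with $\mathrm{dist}_H(u,v)\leq r$ for every vertex $v$ of $H$. *)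

theory Defs
  imports "Graph_Theory.Graph_Theory"
begin

text \<open>
  A finite simple undirected graph is a symmetric loop-free pair digraph (locale
  \<^locale>\<open>pair_graph\<close>): every undirected edge is represented by its two opposite arcs.
\<close>

definition dist_graph :: "'a pair_pre_digraph \<Rightarrow> 'a \<Rightarrow> 'a \<Rightarrow> nat" where
  "dist_graph G u v = (LEAST n. \<exists>p. pre_digraph.apath (with_proj G) u p v \<and> length p = n)"

definition max_degree :: "'a pair_pre_digraph \<Rightarrow> nat" where
  "max_degree G = Max (out_degree (with_proj G) ` pverts G)"

definition radius :: "'a pair_pre_digraph \<Rightarrow> nat" where
  "radius G = (LEAST r. \<exists>u \<in> pverts G. \<forall>v \<in> pverts G. dist_graph G u v \<le> r)"

text \<open>
  The library predicate \<^const>\<open>forest\<close> is about directed cycles, so it fails on every symmetric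
  digraph with an edge (traversing one edge back and forth is a directed cycle of length two).
  The cycles of the underlying undirected graph are the directed cycles of length at least three.
\<close>

definition undirected_tree :: "'a pair_pre_digraph \<Rightarrow> bool" where
  "undirected_tree G \<longleftrightarrow>
     pair_graph G \<and> Digraph_Component.connected (with_proj G) \<and>
     \<not> (\<exists>p. pre_digraph.cycle (with_proj G) p \<and> 3 \<le> length p)"

definition isometric_subgraph :: "'a pair_pre_digraph \<Rightarrow> 'a pair_pre_digraph \<Rightarrow> bool" where
  "isometric_subgraph H G \<longleftrightarrow>
     subgraph (with_proj H) (with_proj G) \<and> Digraph_Component.connected (with_proj H) \<and>
     (\<forall>u \<in> pverts H. \<forall>v \<in> pverts H. dist_graph H u v = dist_graph G u v)"

text \<open>
  \<open>Y\<close> is (a copy of) the graph obtained from \<open>X\<close> by replacing each edge \<open>uv\<close> by a path with \<open>c\<close>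
  new inner vertices: \<open>f\<close> embeds the old vertices, and \<open>s u v\<close> lists the inner vertices of the
  path for \<open>uv\<close> in the order from \<open>u\<close> to \<open>v\<close>. The condition \<open>s v u = rev (s u v)\<close> makes the two
  arcs of an edge share one path.
\<close>

definition c_subdivision :: "nat \<Rightarrow> 'a pair_pre_digraph \<Rightarrow> 'b pair_pre_digraph \<Rightarrow> bool" where
  "c_subdivision c X Y \<longleftrightarrow>
     (\<exists>(f :: 'a \<Rightarrow> 'b) (s :: 'a \<Rightarrow> 'a \<Rightarrow> 'b list).
        inj_on f (pverts X) \<and>
        (\<forall>(u, v) \<in> parcs X.
           length (s u v) = c \<and> distinct (s u v) \<and> s v u = rev (s u v) \<and>
           set (s u v) \<inter> f ` pverts X = {}) \<and>
        (\<forall>(u, v) \<in> parcs X. \<forall>(u', v') \<in> parcs X.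
           {u, v} \<noteq> {u', v'} \<longrightarrow> set (s u v) \<inter> set (s u' v') = {}) \<and>
        pverts Y = f ` pverts X \<union> (\<Union>(u, v) \<in> parcs X. set (s u v)) \<and>
        parcs Y = (\<Union>(u, v) \<in> parcs X. set (vwalk_arcs (f u # s u v @ [f v]))))"

definition edge_covers :: "'a pair_pre_digraph set \<Rightarrow> 'a pair_pre_digraph \<Rightarrow> bool" where
  "edge_covers \<H> G \<longleftrightarrow>
     (\<forall>H \<in> \<H>. subgraph (with_proj H) (with_proj G)) \<and> parcs G = (\<Union>H \<in> \<H>. parcs H)"

end

theory Submission
  imports Defs
begin

text \<open>
  In the 5-subdivision of \<open>X\<close>, cut the path for an edge \<open>uv\<close> at its middle vertex into two halves,
  one at \<open>u\<close> and one at \<open>v\<close>, each with three edges. Colour the halves with \<open>\<Delta> + 1\<close> colours so that halves at the same vertex differ and the two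
  halves of an edge differ; a greedy colouring exists, because a half has at most \<open>\<Delta>\<close> conflicts
  (\<open>half_edge_colouring\<close>).

  One tree joins a new root to all old vertices and so covers the first edge of every half. For each
  colour, a further tree joins a new root to each vertex at distance 2 from the old vertex on a half
  of this colour, and so covers the other two edges of these halves. This is a tree because the two halves of an edge,
  which share the middle vertex, have different colours. Two pendant paths of length 2 at each root,
  added to the host graph as well, ensure that the radius is exactly 2. The host graph is the union of
  these \<open>\<Delta> + 2\<close> trees, and no new edge joins two vertices of the subdivision.

  The trees are isometric since the host graph retracts onto each of them, where edges may collapse
  to vertices (\<open>isometric_subgraph_retract\<close>, \<open>retraction\<close>). The colouring conditions are what makes
  the retractions well defined: two leaves of the same colour tree that lie below different children
  are never adjacent and have no common neighbour. The construction is carried out on a datatype of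
  vertices and transported to the natural numbers at the end.
\<close>

section \<open>Distances and retractions\<close>

lemma Least_eqI_le:
  fixes P Q :: "nat \<Rightarrow> bool"
  assumes "\<And>n. P n \<Longrightarrow> Q n" and "\<And>n. Q n \<Longrightarrow> \<exists>m\<le>n. P m"
  shows "(LEAST n. P n) = (LEAST n. Q n)"
proof (cases "\<exists>n. Q n")
  case True
  then have Q: "Q (LEAST n. Q n)" by (rule LeastI_ex)
  then obtain m where m: "m \<le> (LEAST n. Q n)" "P m" using assms(2) by blast
  then have "P (LEAST n. P n)" by (blast intro: LeastI)
  then have "(LEAST n. Q n) \<le> (LEAST n. P n)" by (blast intro: Least_le assms(1))
  moreover have "(LEAST n. P n) \<le> m" using m(2) by (rule Least_le)
  ultimately show ?thesis using m(1) by linarith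
next
  case False
  then have "P = Q" using assms(1) by blast
  then show ?thesis by simp
qed

context pair_wf_digraph
begin

lemma awalk_length_iff_relpow:
  "(\<exists>p. awalk u p v \<and> length p = n) \<longleftrightarrow> u \<in> pverts G \<and> (u, v) \<in> parcs G ^^ n"
proof (induction n arbitrary: u)
  case 0
  show ?case by (auto simp: awalk_Nil_iff)
next
  case (Suc n)
  have "(\<exists>p. awalk u p v \<and> length p = Suc n) \<longleftrightarrow>
        (\<exists>w. (u, w) \<in> parcs G \<and> (\<exists>p. awalk w p v \<and> length p = n))"
  proof
    assume "\<exists>p. awalk u p v \<and> length p = Suc n"
    then show "\<exists>w. (u, w) \<in> parcs G \<and> (\<exists>p. awalk w p v \<and> length p = n)"
      by (fastforce simp: length_Suc_conv awalk_Cons_iff)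
  next
    assume "\<exists>w. (u, w) \<in> parcs G \<and> (\<exists>p. awalk w p v \<and> length p = n)"
    then obtain w p where "(u, w) \<in> parcs G" "awalk w p v" "length p = n" by blast
    then show "\<exists>p. awalk u p v \<and> length p = Suc n"
      by (intro exI[of _ "(u, w) # p"]) (auto simp: awalk_Cons_iff)
  qed
  also have "\<dots> \<longleftrightarrow> u \<in> pverts G \<and> (u, v) \<in> parcs G ^^ Suc n"
    unfolding Suc.IH using in_arcsD1 in_arcsD2 by (blast intro: relpow_Suc_I2 dest: relpow_Suc_D2)
  finally show ?case .
qed

lemma awalk_imp_shorter_apath:
  assumes "awalk u p v"
  shows "\<exists>q. apath u q v \<and> length q \<le> length p"
  using assms
proof (induct rule: awalk_to_apath_induct)
  case (path p)
  then show ?case by (auto simp: apath_def)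
next
  case (decomp p q r s)
  then have "p = q @ r @ s" by (metis awalk_cyc_decompE)
  then show ?case using decomp by force
qed

lemma dist_graph_eq_Least_relpow:
  assumes "u \<in> pverts G"
  shows "dist_graph G u v = (LEAST n. (u, v) \<in> parcs G ^^ n)"
proof -
  have "dist_graph G u v = (LEAST n. \<exists>p. awalk u p v \<and> length p = n)"
    unfolding dist_graph_def
  proof (rule Least_eqI_le)
    fix n assume "\<exists>p. apath u p v \<and> length p = n"
    then show "\<exists>p. awalk u p v \<and> length p = n" unfolding apath_def by blast
  next
    fix n assume "\<exists>p. awalk u p v \<and> length p = n"
    then show "\<exists>m\<le>n. \<exists>p. apath u p v \<and> length p = m"
      using awalk_imp_shorter_apath by blast
  qed
  then show ?thesis using assms by (simp add: awalk_length_iff_relpow)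
qed

end

lemma relpow_retract:
  assumes "(x, y) \<in> R ^^ n"
    and "\<And>x y. (x, y) \<in> R \<Longrightarrow> \<rho> x = \<rho> y \<or> (\<rho> x, \<rho> y) \<in> S"
  shows "\<exists>m\<le>n. (\<rho> x, \<rho> y) \<in> S ^^ m"
  using assms(1)
proof (induction n arbitrary: y)
  case 0
  then show ?case by auto
next
  case (Suc n)
  then obtain z where z: "(x, z) \<in> R ^^ n" "(z, y) \<in> R" by auto
  obtain m where m: "m \<le> n" "(\<rho> x, \<rho> z) \<in> S ^^ m" using Suc.IH[OF z(1)] by blast
  from assms(2)[OF z(2)] show ?case
  proof
    assume "\<rho> z = \<rho> y"
    then show ?thesis using m by (intro exI[of _ m]) auto
  next
    assume "(\<rho> z, \<rho> y) \<in> S"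
    then show ?thesis using m by (intro exI[of _ "Suc m"]) auto
  qed
qed

text \<open>
  A map of the vertices of \<open>G\<close> that fixes \<open>H\<close> and sends each arc of \<open>G\<close> to an arc of \<open>H\<close> or to a
  single vertex sends walks of \<open>G\<close> to walks of \<open>H\<close> that are no longer, so that \<open>G\<close> has no
  shortcut between two vertices of \<open>H\<close>.
\<close>
lemma isometric_subgraph_retract:
  assumes sub: "subgraph (with_proj H) (with_proj G)"
    and con: "Digraph_Component.connected (with_proj H)"
    and fix_H: "\<And>x. x \<in> pverts H \<Longrightarrow> \<rho> x = x"
    and arcs: "\<And>x y. (x, y) \<in> parcs G \<Longrightarrow> \<rho> x = \<rho> y \<or> (\<rho> x, \<rho> y) \<in> parcs H"
  shows "isometric_subgraph H G"
proof -
  have wf: "pair_wf_digraph H" "pair_wf_digraph G"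
    using sub by (auto simp: wf_digraph_wp_iff)
  have verts: "pverts H \<subseteq> pverts G" and sub_arcs: "parcs H \<subseteq> parcs G"
    using sub by (auto simp: subgraph_def)
  have "dist_graph H u v = dist_graph G u v" if u: "u \<in> pverts H" and v: "v \<in> pverts H" for u v
  proof -
    have "(LEAST n. (u, v) \<in> parcs H ^^ n) = (LEAST n. (u, v) \<in> parcs G ^^ n)"
    proof (rule Least_eqI_le)
      fix n assume "(u, v) \<in> parcs H ^^ n"
      then show "(u, v) \<in> parcs G ^^ n" by (induction n arbitrary: v) (use sub_arcs in auto)
    next
      fix n assume "(u, v) \<in> parcs G ^^ n"
      then show "\<exists>m\<le>n. (u, v) \<in> parcs H ^^ m"
        using relpow_retract[where \<rho> = \<rho>, OF _ arcs] fix_H u v by metis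
    qed
    then show ?thesis
      using u verts by (simp add: pair_wf_digraph.dist_graph_eq_Least_relpow wf subset_iff)
  qed
  then show ?thesis using sub con by (simp add: isometric_subgraph_def)
qed

section \<open>Trees of radius two\<close>

lemma pcas_nth_Suc:
  assumes "pcas u p v" "Suc k < length p"
  shows "fst (p ! Suc k) = snd (p ! k)"
  using assms
proof (induction u p v arbitrary: k rule: pcas.induct)
  case (2 u e es v)
  then show ?case by (cases k; cases es) auto
qed auto

lemma pcas_ends:
  assumes "pcas u p v" "p \<noteq> []"
  shows "fst (p ! 0) = u" "snd (p ! (length p - 1)) = v"
  using assms by (induction u p v rule: pcas.induct) (auto simp: nth_Cons')

text \<open>
  On a cycle of length at least three, a vertex of maximal rank \<open>d\<close> has two distinct neighbours of
  rank at most its own.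
\<close>
lemma no_long_cycle_if_ranked:
  fixes d :: "'a \<Rightarrow> nat"
  assumes sym: "sym (parcs G)"
    and unique: "\<And>v w w'. (v, w) \<in> parcs G \<Longrightarrow> (v, w') \<in> parcs G \<Longrightarrow>
      d w \<le> d v \<Longrightarrow> d w' \<le> d v \<Longrightarrow> w = w'"
  shows "\<not> (\<exists>p. pre_digraph.cycle (with_proj G) p \<and> 3 \<le> length p)"
proof
  assume "\<exists>p. pre_digraph.cycle (with_proj G) p \<and> 3 \<le> length p"
  then obtain u p where p: "set p \<subseteq> parcs G" "pcas u p u"
      "distinct (tl (pawalk_verts u p))" "3 \<le> length p"
    unfolding pre_digraph.cycle_def pre_digraph.awalk_def
      cas_with_proj_eq awalk_verts_with_proj_eq with_proj_simps by blast
  define n y where "n = length p" and "y k = snd (p ! k)" for k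
  have "pawalk_verts a q = a # map snd q" if "pcas a q b" for a b and q :: "('a \<times> 'a) list"
    using that by (induction a q b rule: pcas.induct) auto
  from this[OF p(2)] have inj: "y i = y j \<longleftrightarrow> i = j" if "i < n" "j < n" for i j
    using p(3) that by (simp add: distinct_conv_nth n_def y_def) blast
  have arc: "(y i, y j) \<in> parcs G" if "j < n" "i = (if j = 0 then n - 1 else j - 1)" for i j
  proof -
    have "p \<noteq> []" using p(4) by auto
    then have "fst (p ! j) = y i"
      using that pcas_nth_Suc[OF p(2), of "j - 1"] pcas_ends[OF p(2)]
      by (auto simp: y_def n_def)
    then have "p ! j = (y i, y j)" by (simp add: prod_eq_iff y_def)
    then show ?thesis using p(1) that(1) nth_mem[of j p] by (auto simp: n_def)
  qed
  define m where "m = Max ((\<lambda>j. d (y j)) ` {..<n})"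
  have "m \<in> (\<lambda>j. d (y j)) ` {..<n}" unfolding m_def
    by (rule Max_in) (use p(4) in \<open>auto simp: n_def lessThan_empty_iff\<close>)
  then obtain k where k: "k < n" and "d (y k) = m" by auto
  then have max: "d (y j) \<le> d (y k)" if "j < n" for j
    using that by (simp add: m_def)
  (* the predecessor and the successor of position k on the cycle *)
  define i where "i = (if k = 0 then n - 1 else k - 1)"
  define j where "j = (if k = n - 1 then 0 else k + 1)"
  have ij: "i < n" "j < n" "i \<noteq> j" using k p(4) by (auto simp: i_def j_def n_def)
  have "(y k, y i) \<in> parcs G"
    using arc[of k i] k sym by (auto simp: i_def dest: symD)
  moreover have "(y k, y j) \<in> parcs G"
    by (rule arc) (use ij(2) k in \<open>auto simp: j_def\<close>)
  ultimately have "y i = y j" using unique max ij by blast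
  then show False using inj ij by blast
qed

text \<open>
  The symmetric graph in which the root \<open>r\<close> is joined to the vertices in \<open>M\<close>, and each pair
  \<open>(x, y)\<close> in \<open>E\<close> joins a child \<open>x \<in> M\<close> of the root to a leaf \<open>y\<close> below it. Children without
  leaves are possible.
\<close>
definition two_level :: "'a \<Rightarrow> 'a set \<Rightarrow> 'a rel \<Rightarrow> 'a pair_pre_digraph" where
  "two_level r M E = \<lparr>pverts = insert r (M \<union> Range E),
     parcs = ({r} \<times> M \<union> E) \<union> ({r} \<times> M \<union> E)\<inverse>\<rparr>"

locale two_level_tree =
  fixes r :: 'a and M :: "'a set" and E :: "'a rel"
  assumes finite_M: "finite M" and finite_E: "finite E"
    and Domain_E: "Domain E \<subseteq> M"
    and disjoint: "r \<notin> M" "r \<notin> Range E" "M \<inter> Range E = {}"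
    and parent_unique: "\<And>x x' y. (x, y) \<in> E \<Longrightarrow> (x', y) \<in> E \<Longrightarrow> x = x'"
begin

abbreviation T :: "'a pair_pre_digraph" where "T \<equiv> two_level r M E"

lemma pair_graph_T: "pair_graph T"
proof
  show "symmetric (with_proj T)"
    by (auto simp: symmetric_def two_level_def sym_def)
  show "finite (pverts T)" "finite (parcs T)"
    using finite_M finite_E by (auto simp: two_level_def finite_Range)
  have "x \<noteq> y" if "(x, y) \<in> E" for x y using that Domain_E disjoint by auto
  then show "fst a \<noteq> snd a" if "a \<in> parcs T" for a
    using that disjoint(1) by (cases a) (auto simp: two_level_def)
qed (use Domain_E in \<open>auto simp: two_level_def\<close>)

sublocale T: pair_graph T by (rule pair_graph_T)

lemma to_root:
  assumes "u \<in> pverts T"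
  shows "\<exists>n\<le>2. (u, r) \<in> parcs T ^^ n \<and> (r, u) \<in> parcs T ^^ n"
proof -
  consider "u = r" | "u \<in> M" | x where "(x, u) \<in> E" "x \<in> M"
    using assms Domain_E by (auto simp: two_level_def)
  then show ?thesis
  proof cases
    case 1
    then show ?thesis by (intro exI[of _ 0]) auto
  next
    case 2
    then show ?thesis by (intro exI[of _ 1]) (auto simp: two_level_def)
  next
    case 3
    then have "(u, x) \<in> parcs T" "(x, u) \<in> parcs T" "(x, r) \<in> parcs T" "(r, x) \<in> parcs T"
      by (auto simp: two_level_def)
    then show ?thesis by (intro exI[of _ 2]) (auto simp: numeral_2_eq_2)
  qed
qed

lemma relpow_exists:
  assumes "u \<in> pverts T" "v \<in> pverts T"
  shows "\<exists>n. (u, v) \<in> parcs T ^^ n"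
proof -
  obtain n m where "(u, r) \<in> parcs T ^^ n" "(r, v) \<in> parcs T ^^ m"
    using to_root assms by blast
  then have "(u, v) \<in> parcs T ^^ (n + m)" by (auto simp: relpow_add)
  then show ?thesis ..
qed

lemma connected_T: "Digraph_Component.connected (with_proj T)"
proof -
  have "u \<rightarrow>\<^sup>*\<^bsub>with_proj T\<^esub> v" if "u \<in> pverts T" "v \<in> pverts T" for u v
    using relpow_exists[OF that] that T.awalk_length_iff_relpow T.reachable_awalk by blast
  moreover have "r \<in> pverts T" by (simp add: two_level_def)
  ultimately show ?thesis
    unfolding connected_def strongly_connected_def
    by (auto intro: T.reachable_mk_symmetricI)
qed

lemma undirected_tree_T: "undirected_tree T"
proof -
  define d where "d x = (if x = r then 0 else if x \<in> M then 1 else 2 :: nat)" for x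
  have "\<not> (\<exists>p. pre_digraph.cycle (with_proj T) p \<and> 3 \<le> length p)"
  proof (rule no_long_cycle_if_ranked)
    show "sym (parcs T)" by (auto simp: two_level_def sym_def)
    fix v w w'
    assume "(v, w) \<in> parcs T" "(v, w') \<in> parcs T" "d w \<le> d v" "d w' \<le> d v"
    moreover have "x \<in> M" "y \<noteq> r" "y \<notin> M" "x \<noteq> r" if "(x, y) \<in> E" for x y
      using that disjoint Domain_E by auto
    ultimately show "w = w'"
      using disjoint(1) parent_unique
      by (auto simp: two_level_def d_def split: if_splits)
  qed
  then show ?thesis using pair_graph_T connected_T by (simp add: undirected_tree_def)
qed

text \<open>
  Two leaves below different children exclude radius one: no vertex is within distance one of both.
\<close>
lemma radius_T:
  assumes leaves: "(x, y) \<in> E" "(x', y') \<in> E" "x \<noteq> x'"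
  shows "radius T = 2"
  unfolding radius_def
proof (rule Least_equality)
  have "dist_graph T r v \<le> 2" if v: "v \<in> pverts T" for v
  proof -
    obtain n where "n \<le> 2" "(r, v) \<in> parcs T ^^ n" using to_root[OF v] by blast
    moreover have "r \<in> pverts T" by (simp add: two_level_def)
    ultimately show ?thesis
      using Least_le[of "\<lambda>n. (r, v) \<in> parcs T ^^ n" n]
      by (simp add: T.dist_graph_eq_Least_relpow)
  qed
  moreover have "r \<in> pverts T" by (simp add: two_level_def)
  ultimately show "\<exists>u\<in>pverts T. \<forall>v\<in>pverts T. dist_graph T u v \<le> 2" by blast
next
  fix s
  assume "\<exists>u\<in>pverts T. \<forall>v\<in>pverts T. dist_graph T u v \<le> s"
  then obtain u where u: "u \<in> pverts T" and le: "\<And>v. v \<in> pverts T \<Longrightarrow> dist_graph T u v \<le> s" by blast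
  show "2 \<le> s"
  proof (rule ccontr)
    assume "\<not> 2 \<le> s"
    (* a vertex within distance one of a leaf b is b or its parent a *)
    have near: "u = b \<or> u = a" if "(a, b) \<in> E" for a b
    proof -
      have b: "b \<in> pverts T" using that by (auto simp: two_level_def)
      define n where "n = dist_graph T u b"
      have "(u, b) \<in> parcs T ^^ n"
        using LeastI_ex[OF relpow_exists[OF u b]] u by (simp add: n_def T.dist_graph_eq_Least_relpow)
      moreover have "n = 0 \<or> n = 1" using le[OF b] \<open>\<not> 2 \<le> s\<close> by (auto simp: n_def)
      ultimately have "u = b \<or> (u, b) \<in> parcs T" by auto
      moreover have "b \<noteq> r" "b \<notin> M" using that disjoint by blast+
      moreover from this have "(b, u) \<notin> E" using Domain_E by blast
      ultimately have "u = b \<or> (u, b) \<in> E" by (auto simp: two_level_def)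
      then show ?thesis using parent_unique that by blast
    qed
    have "x \<noteq> y'" "x' \<noteq> y" using leaves(1,2) disjoint(3) Domain_E by blast+
    moreover have "y \<noteq> y'" using leaves parent_unique by blast
    ultimately show False using near[OF leaves(1)] near[OF leaves(2)] leaves(3) by auto
  qed
qed

end

section \<open>Renaming vertices\<close>

text \<open>
  The image of a graph under a vertex map. It is used for maps that are injective on the vertices
  only, which is why the map is not required to be injective on the type.
\<close>
definition relabel :: "('a \<Rightarrow> 'b) \<Rightarrow> 'a pair_pre_digraph \<Rightarrow> 'b pair_pre_digraph" where
  "relabel e G = \<lparr>pverts = e ` pverts G, parcs = map_prod e e ` parcs G\<rparr>"

lemma relabel_simps [simp]:
  "pverts (relabel e G) = e ` pverts G"
  "parcs (relabel e G) = map_prod e e ` parcs G"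
  by (simp_all add: relabel_def)

lemma relabel_two_level:
  fixes e :: "'a \<Rightarrow> 'b"
  shows "relabel e (two_level r M E) = two_level (e r) (e ` M) (map_prod e e ` E)"
proof -
  have "map_prod e e ` (D\<inverse>) = (map_prod e e ` D)\<inverse>" for D :: "'a rel" by force
  moreover have "Range (map_prod e e ` E) = e ` Range E" by force
  moreover have "map_prod e e ` ({r} \<times> M) = {e r} \<times> e ` M" by force
  ultimately show ?thesis by (simp add: two_level_def relabel_def image_Un)
qed

lemma (in two_level_tree) two_level_tree_relabel:
  assumes inj: "inj_on e (pverts T)"
  shows "two_level_tree (e r) (e ` M) (map_prod e e ` E)"
proof
  have V: "r \<in> pverts T" "M \<subseteq> pverts T" "Range E \<subseteq> pverts T" "Domain E \<subseteq> pverts T"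
    using Domain_E by (auto simp: two_level_def)
  show "e r \<notin> e ` M" using V disjoint inj_on_image_mem_iff[OF inj] by blast
  have R: "Range (map_prod e e ` E) = e ` Range E" "Domain (map_prod e e ` E) = e ` Domain E"
    by force+
  show "e r \<notin> Range (map_prod e e ` E)"
    unfolding R using V disjoint inj_on_image_mem_iff[OF inj] by blast
  show "Domain (map_prod e e ` E) \<subseteq> e ` M" unfolding R using Domain_E by blast
  show "e ` M \<inter> Range (map_prod e e ` E) = {}"
    unfolding R using V disjoint(3) inj_on_image_Int[OF inj, of M "Range E"] by simp
  fix x x' y assume "(x, y) \<in> map_prod e e ` E" "(x', y) \<in> map_prod e e ` E"
  then obtain a b a' b' where E: "(a, b) \<in> E" "(a', b') \<in> E" "e b = e b'" "x = e a" "x' = e a'"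
    by auto
  then have "b = b'" using V(3) inj by (auto dest: inj_onD)
  then show "x = x'" using E parent_unique by blast
qed (use finite_M finite_E in auto)

lemma pair_graph_relabel:
  assumes "pair_graph G" and inj: "inj_on e (pverts G)"
  shows "pair_graph (relabel e G)"
proof -
  interpret pair_graph G by fact
  show ?thesis
  proof
    show "finite (pverts (relabel e G))" "finite (parcs (relabel e G))"
      by (simp_all add: pair_finite_verts pair_finite_arcs)
    show "symmetric (with_proj (relabel e G))"
      by (auto simp: symmetric_def sym_def intro: arcs_symmetric map_prod_imageI)
    fix a assume "a \<in> parcs (relabel e G)"
    then obtain u v where uv: "(u, v) \<in> parcs G" "a = (e u, e v)" by auto
    then show "fst a \<in> pverts (relabel e G)" "snd a \<in> pverts (relabel e G)"
      by (auto dest: in_arcsD1 in_arcsD2)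
    show "fst a \<noteq> snd a"
      using uv inj by (auto dest: in_arcsD1 in_arcsD2 no_loops' inj_onD)
  qed
qed

text \<open>Retractions in the sense of \<open>isometric_subgraph_retract\<close> are preserved by renaming.\<close>
lemma relabel_retraction:
  assumes inj: "inj_on e (pverts G)" and wf: "pair_wf_digraph G" and sub: "pverts H \<subseteq> pverts G"
    and fix_H: "\<And>x. x \<in> pverts H \<Longrightarrow> \<rho> x = x"
    and arcs: "\<And>x y. (x, y) \<in> parcs G \<Longrightarrow> \<rho> x = \<rho> y \<or> (\<rho> x, \<rho> y) \<in> parcs H"
  obtains \<rho>' where "\<And>x. x \<in> pverts (relabel e H) \<Longrightarrow> \<rho>' x = x"
    and "\<And>x y. (x, y) \<in> parcs (relabel e G) \<Longrightarrow> \<rho>' x = \<rho>' y \<or> (\<rho>' x, \<rho>' y) \<in> parcs (relabel e H)"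
proof
  interpret pair_wf_digraph G by fact
  let ?\<rho> = "\<lambda>x. e (\<rho> (inv_into (pverts G) e x))"
  show "?\<rho> x = x" if "x \<in> pverts (relabel e H)" for x
    using that inj sub fix_H by auto
  fix x y assume "(x, y) \<in> parcs (relabel e G)"
  then obtain u v where uv: "(u, v) \<in> parcs G" "x = e u" "y = e v" by auto
  then have "?\<rho> x = e (\<rho> u)" "?\<rho> y = e (\<rho> v)"
    using inj by (auto dest: in_arcsD1 in_arcsD2)
  then show "?\<rho> x = ?\<rho> y \<or> (?\<rho> x, ?\<rho> y) \<in> parcs (relabel e H)"
    using arcs[OF uv(1)] by (auto intro: map_prod_imageI)
qed

lemma induced_subgraph_relabel:
  assumes inj: "inj_on e (pverts G)" and "induced_subgraph (with_proj H) (with_proj G)"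
    and wf: "pair_wf_digraph (relabel e G)"
  shows "induced_subgraph (with_proj (relabel e H)) (with_proj (relabel e G))"
proof -
  have sub: "subgraph (with_proj H) (with_proj G)"
    and arcs: "parcs H = {a \<in> parcs G. fst a \<in> pverts H \<and> snd a \<in> pverts H}"
    using assms(2) by (auto simp: induced_subgraph_def)
  have verts: "pverts H \<subseteq> pverts G" and "pair_wf_digraph G"
    using sub by (auto simp: subgraph_def wf_digraph_wp_iff)
  interpret pair_wf_digraph G by fact
  have "parcs (relabel e H) =
    {a \<in> parcs (relabel e G). fst a \<in> pverts (relabel e H) \<and> snd a \<in> pverts (relabel e H)}"
    (is "_ = ?R")
  proof
    show "parcs (relabel e H) \<subseteq> ?R" by (auto simp: arcs)
    show "?R \<subseteq> parcs (relabel e H)"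
    proof
      fix a assume "a \<in> ?R"
      then obtain u v where uv: "(u, v) \<in> parcs G" "a = (e u, e v)" "e u \<in> e ` pverts H" "e v \<in> e ` pverts H"
        by auto
      then have "u \<in> pverts H" "v \<in> pverts H"
        using inj_on_image_mem_iff[OF inj _ verts] by (auto dest: in_arcsD1 in_arcsD2)
      then show "a \<in> parcs (relabel e H)" using uv by (auto simp: arcs)
    qed
  qed
  moreover have "subgraph (with_proj (relabel e H)) (with_proj (relabel e G))"
  proof (rule subgraphI)
    show "wf_digraph (with_proj (relabel e H))"
      unfolding wf_digraph_wp_iff using calculation by unfold_locales auto
    show "arcs (with_proj (relabel e H)) \<subseteq> arcs (with_proj (relabel e G))"
      using calculation by auto
  qed (use verts wf in \<open>auto simp: compatible_def wf_digraph_wp_iff\<close>)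
  ultimately show ?thesis by (auto simp: induced_subgraph_def)
qed

lemma vwalk_arcs_map: "vwalk_arcs (map e xs) = map (map_prod e e) (vwalk_arcs xs)"
  by (induction xs rule: vwalk_arcs.induct) auto

lemma c_subdivision_relabel:
  assumes "c_subdivision c X Y" and inj: "inj_on e (pverts Y)"
  shows "c_subdivision c X (relabel e Y)"
proof -
  from assms(1) obtain f s where f: "inj_on f (pverts X)"
    and s_ball: "\<forall>(u, v) \<in> parcs X. length (s u v) = c \<and> distinct (s u v) \<and>
      s v u = rev (s u v) \<and> set (s u v) \<inter> f ` pverts X = {}"
    and disj_ball: "\<forall>(u, v) \<in> parcs X. \<forall>(u', v') \<in> parcs X.
      {u, v} \<noteq> {u', v'} \<longrightarrow> set (s u v) \<inter> set (s u' v') = {}"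
    and verts: "pverts Y = f ` pverts X \<union> (\<Union>(u, v) \<in> parcs X. set (s u v))"
    and arcs: "parcs Y = (\<Union>(u, v) \<in> parcs X. set (vwalk_arcs (f u # s u v @ [f v])))"
    unfolding c_subdivision_def by (elim exE conjE) (rule that)
  have s: "length (s u v) = c \<and> distinct (s u v) \<and> s v u = rev (s u v) \<and>
      set (s u v) \<inter> f ` pverts X = {}" if "(u, v) \<in> parcs X" for u v
    using s_ball that by fast
  have disj: "set (s u v) \<inter> set (s u' v') = {}"
    if "(u, v) \<in> parcs X" "(u', v') \<in> parcs X" "{u, v} \<noteq> {u', v'}" for u v u' v'
    using disj_ball that by fast
  have sub: "f ` pverts X \<subseteq> pverts Y" "\<And>u v. (u, v) \<in> parcs X \<Longrightarrow> set (s u v) \<subseteq> pverts Y"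
    using verts by auto
  have disj_image: "e ` A \<inter> e ` B = {}" if "A \<subseteq> pverts Y" "B \<subseteq> pverts Y" "A \<inter> B = {}" for A B
    using inj_on_image_Int[OF inj that(1,2)] that(3) by simp
  let ?f = "\<lambda>x. e (f x)" and ?s = "\<lambda>u v. map e (s u v)"
  have "inj_on ?f (pverts X)"
    using comp_inj_on[OF f inj_on_subset[OF inj sub(1)]] by (simp add: comp_def)
  moreover have "\<forall>(u, v) \<in> parcs X. length (?s u v) = c \<and> distinct (?s u v) \<and>
      ?s v u = rev (?s u v) \<and> set (?s u v) \<inter> ?f ` pverts X = {}"
  proof (intro ballI, split prod.split, intro allI impI)
    fix a u v assume "a \<in> parcs X" "a = (u, v)"
    then have uv: "(u, v) \<in> parcs X" by simp
    show "length (?s u v) = c \<and> distinct (?s u v) \<and>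
      ?s v u = rev (?s u v) \<and> set (?s u v) \<inter> ?f ` pverts X = {}"
      using s[OF uv] disj_image[OF sub(2)[OF uv] sub(1)] inj_on_subset[OF inj sub(2)[OF uv]]
      by (simp add: distinct_map rev_map image_image)
  qed
  moreover have "\<forall>(u, v) \<in> parcs X. \<forall>(u', v') \<in> parcs X.
      {u, v} \<noteq> {u', v'} \<longrightarrow> set (?s u v) \<inter> set (?s u' v') = {}"
  proof (intro ballI, split prod.split, intro allI impI, intro ballI, split prod.split, intro allI impI)
    fix a u v a' u' v'
    assume "a \<in> parcs X" "a = (u, v)" "a' \<in> parcs X" "a' = (u', v')" and ne: "{u, v} \<noteq> {u', v'}"
    then have uv: "(u, v) \<in> parcs X" "(u', v') \<in> parcs X" by simp_all
    show "set (?s u v) \<inter> set (?s u' v') = {}"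
      using disj_image[OF sub(2)[OF uv(1)] sub(2)[OF uv(2)] disj[OF uv ne]] by simp
  qed
  moreover have "pverts (relabel e Y) = ?f ` pverts X \<union> (\<Union>(u, v) \<in> parcs X. set (?s u v))"
    by (auto simp: verts image_Un image_UN image_image)
  moreover have "parcs (relabel e Y) =
      (\<Union>(u, v) \<in> parcs X. set (vwalk_arcs (?f u # ?s u v @ [?f v])))"
  proof -
    have "set (vwalk_arcs (?f u # ?s u v @ [?f v])) =
        map_prod e e ` set (vwalk_arcs (f u # s u v @ [f v]))" for u v
      using vwalk_arcs_map[of e "f u # s u v @ [f v]"]
      by (simp del: vwalk_arcs_Cons)
    then show ?thesis
      by (simp only: relabel_simps arcs image_UN split_def)
  qed
  ultimately show ?thesis
    unfolding c_subdivision_def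
    by (intro exI[of _ ?f] exI[of _ ?s] conjI)
qed

section \<open>Colouring half-edges\<close>

lemma greedy_colouring:
  assumes A: "finite A" and C: "finite C"
    and sym: "\<And>a b. conf a b \<Longrightarrow> conf b a"
    and few: "\<And>a. a \<in> A \<Longrightarrow> card {b \<in> A. b \<noteq> a \<and> conf a b} < card C"
  shows "\<exists>col. col ` A \<subseteq> C \<and> (\<forall>a\<in>A. \<forall>b\<in>A. a \<noteq> b \<longrightarrow> conf a b \<longrightarrow> col a \<noteq> col b)"
  using A few
proof (induction A)
  case empty
  then show ?case by simp
next
  case (insert x A)
  have "card {b \<in> A. b \<noteq> a \<and> conf a b} < card C" if "a \<in> A" for a
  proof -
    have "card {b \<in> A. b \<noteq> a \<and> conf a b} \<le> card {b \<in> insert x A. b \<noteq> a \<and> conf a b}"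
      using insert.hyps(1) by (intro card_mono) auto
    then show ?thesis using insert.prems[of a] that by simp
  qed
  then obtain col where col: "col ` A \<subseteq> C"
      "\<forall>a\<in>A. \<forall>b\<in>A. a \<noteq> b \<longrightarrow> conf a b \<longrightarrow> col a \<noteq> col b"
    using insert.IH by blast
  let ?B = "{b \<in> A. conf x b}"
  have "{b \<in> insert x A. b \<noteq> x \<and> conf x b} = ?B" using insert.hyps(2) by auto
  then have "card ?B < card C" using insert.prems[of x] by simp
  then have "card (col ` ?B) < card C"
    using card_image_le[of ?B col] insert.hyps(1) by simp
  then have "\<not> C \<subseteq> col ` ?B"
    using card_mono[of "col ` ?B" C] insert.hyps(1) by fastforce
  then obtain c where c: "c \<in> C" "c \<notin> col ` ?B" by blast
  have "(col(x := c)) ` insert x A \<subseteq> C" using col(1) c(1) by auto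
  moreover have "(col(x := c)) a \<noteq> (col(x := c)) b"
    if "a \<in> insert x A" "b \<in> insert x A" "a \<noteq> b" "conf a b" for a b
    using that col(2) c(2) sym[of a b] by (auto simp: image_iff)
  ultimately show ?case by blast
qed

text \<open>
  The arc \<open>(u, v)\<close> stands for the half of the edge \<open>uv\<close> at \<open>u\<close>. Such a half conflicts with the other
  halves at \<open>u\<close>, of which there are at most \<open>D - 1\<close>, and with the other half of its own edge, so that
  \<open>D + 1\<close> colours suffice. The colours start at 2 because they serve as indices of trees, where
  index 1 has another role.
\<close>
lemma (in pair_graph) half_edge_colouring:
  assumes degree: "\<And>u. u \<in> pverts G \<Longrightarrow> card {a \<in> parcs G. fst a = u} \<le> D"
  obtains col where "\<And>u v. (u, v) \<in> parcs G \<Longrightarrow> col (u, v) \<in> {2..D + 2}"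
    and "\<And>u v. (u, v) \<in> parcs G \<Longrightarrow> col (u, v) \<noteq> col (v, u)"
    and "\<And>u v w. (u, v) \<in> parcs G \<Longrightarrow> (u, w) \<in> parcs G \<Longrightarrow> col (u, v) = col (u, w) \<Longrightarrow> v = w"
proof -
  define conf where "conf a b \<longleftrightarrow> fst a = fst b \<or> b = (snd a, fst a)" for a b :: "'a \<times> 'a"
  have "\<exists>col. col ` parcs G \<subseteq> {2..D + 2} \<and>
      (\<forall>a\<in>parcs G. \<forall>b\<in>parcs G. a \<noteq> b \<longrightarrow> conf a b \<longrightarrow> col a \<noteq> col b)"
  proof (rule greedy_colouring)
    show "conf b a" if "conf a b" for a b using that by (auto simp: conf_def)
    fix a assume a: "a \<in> parcs G"
    let ?S = "{b \<in> parcs G. fst b = fst a}"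
    have fin: "finite ?S" using pair_finite_arcs by simp
    have "card {b \<in> parcs G. b \<noteq> a \<and> conf a b} \<le> card (insert (snd a, fst a) (?S - {a}))"
      using fin by (intro card_mono) (auto simp: conf_def)
    also have "\<dots> \<le> Suc (card (?S - {a}))" by (rule card_insert_le_m1) simp_all
    also have "\<dots> = card ?S" using a fin by (intro card_Suc_Diff1) auto
    also have "\<dots> \<le> D" using degree arc_fst_in_verts a by blast
    finally show "card {b \<in> parcs G. b \<noteq> a \<and> conf a b} < card {2..D + 2}" by simp
  qed (use pair_finite_arcs in auto)
  then obtain col where col: "col ` parcs G \<subseteq> {2..D + 2}"
    and proper: "\<And>a b. a \<in> parcs G \<Longrightarrow> b \<in> parcs G \<Longrightarrow> a \<noteq> b \<Longrightarrow> conf a b \<Longrightarrow> col a \<noteq> col b"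
    by blast
  show ?thesis
  proof (rule that[of col])
    fix u v assume uv: "(u, v) \<in> parcs G"
    then show "col (u, v) \<in> {2..D + 2}" using col by blast
    show "col (u, v) \<noteq> col (v, u)"
      using proper[OF uv arcs_symmetric[OF uv]] no_loops'[OF uv] by (auto simp: conf_def)
    fix w assume "(u, w) \<in> parcs G" "col (u, v) = col (u, w)"
    then show "v = w" using proper[OF uv, of "(u, w)"] by (auto simp: conf_def)
  qed
qed

section \<open>The host graph\<close>

text \<open>
  The path that replaces an edge \<open>uv\<close> is \<open>Old u\<close>, \<open>Near u v\<close>, \<open>Quarter u v\<close>, \<open>Mid {u, v}\<close>,
  \<open>Quarter v u\<close>, \<open>Near v u\<close>, \<open>Old v\<close>. The vertex \<open>Centre i\<close> is the root of the tree with index \<open>i\<close>,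
  to which two pendant paths \<open>Centre i\<close>, \<open>Child i b\<close>, \<open>Leaf i b\<close> (one for each Boolean \<open>b\<close>) are
  attached.
\<close>
datatype 'a gvert = Old 'a | Near 'a 'a | Quarter 'a 'a | Mid "'a set"
  | Centre nat | Child nat bool | Leaf nat bool

text \<open>The 5-subdivision on these vertices.\<close>
definition subdivision5 :: "'a pair_pre_digraph \<Rightarrow> 'a gvert pair_pre_digraph" where
  "subdivision5 X = \<lparr>
     pverts = Old ` pverts X \<union>
       (\<Union>(u, v) \<in> parcs X. {Near u v, Quarter u v, Mid {u, v}, Quarter v u, Near v u}),
     parcs = (\<Union>(u, v) \<in> parcs X. set (vwalk_arcs
       [Old u, Near u v, Quarter u v, Mid {u, v}, Quarter v u, Near v u, Old v]))\<rparr>"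

text \<open>
  The children of the root of the tree with index \<open>i\<close>, and the pairs of a child and a leaf below it.
  The tree with index 1 contains the star at each old vertex in the subdivision; the tree with index
  \<open>i \<noteq> 1\<close> contains, for each half-edge \<open>(u, v)\<close> of colour \<open>i\<close>, the two edges at \<open>Quarter u v\<close>.
  The two pendant paths make the radius equal to 2 even if no half-edge has colour \<open>i\<close>.
\<close>
definition children :: "'a pair_pre_digraph \<Rightarrow> ('a \<times> 'a \<Rightarrow> nat) \<Rightarrow> nat \<Rightarrow> 'a gvert set" where
  "children X col i = range (Child i) \<union>
     (if i = 1 then Old ` pverts X
      else {Quarter u v | u v. (u, v) \<in> parcs X \<and> col (u, v) = i})"

definition leaf_arcs :: "'a pair_pre_digraph \<Rightarrow> ('a \<times> 'a \<Rightarrow> nat) \<Rightarrow> nat \<Rightarrow> 'a gvert rel" where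
  "leaf_arcs X col i = range (\<lambda>b. (Child i b, Leaf i b)) \<union>
     (if i = 1 then {(Old u, Near u v) | u v. (u, v) \<in> parcs X}
      else {(Quarter u v, Near u v) | u v. (u, v) \<in> parcs X \<and> col (u, v) = i} \<union>
        {(Quarter u v, Mid {u, v}) | u v. (u, v) \<in> parcs X \<and> col (u, v) = i})"

definition cover_tree :: "'a pair_pre_digraph \<Rightarrow> ('a \<times> 'a \<Rightarrow> nat) \<Rightarrow> nat \<Rightarrow> 'a gvert pair_pre_digraph" where
  "cover_tree X col i = two_level (Centre i) (children X col i) (leaf_arcs X col i)"

text \<open>The union of the trees with index in \<open>I\<close>.\<close>
definition host :: "'a pair_pre_digraph \<Rightarrow> ('a \<times> 'a \<Rightarrow> nat) \<Rightarrow> nat set \<Rightarrow> 'a gvert pair_pre_digraph" where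
  "host X col I = \<lparr>pverts = \<Union>i\<in>I. pverts (cover_tree X col i),
     parcs = \<Union>i\<in>I. parcs (cover_tree X col i)\<rparr>"

(* Otherwise facts about the index 1 would not match goals rewritten to Suc 0. *)
declare One_nat_def [simp del]

lemma (in pair_graph) c_subdivision_subdivision5: "c_subdivision 5 G (subdivision5 G)"
  unfolding c_subdivision_def
proof (intro exI conjI)
  let ?s = "\<lambda>u v. [Near u v, Quarter u v, Mid {u, v}, Quarter v u, Near v u]"
  show "inj_on Old (pverts G)" by (simp add: inj_on_def)
  show "\<forall>(u, v)\<in>parcs G. length (?s u v) = 5 \<and> distinct (?s u v) \<and> ?s v u = rev (?s u v) \<and>
      set (?s u v) \<inter> Old ` pverts G = {}"
    by (auto simp: insert_commute dest: no_loops')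
  show "\<forall>(u, v)\<in>parcs G. \<forall>(u', v')\<in>parcs G. {u, v} \<noteq> {u', v'} \<longrightarrow>
      set (?s u v) \<inter> set (?s u' v') = {}"
    by (auto simp: doubleton_eq_iff)
  show "pverts (subdivision5 G) = Old ` pverts G \<union> (\<Union>(u, v)\<in>parcs G. set (?s u v))"
    by (simp add: subdivision5_def)
  show "parcs (subdivision5 G) = (\<Union>(u, v)\<in>parcs G. set (vwalk_arcs (Old u # ?s u v @ [Old v])))"
    by (simp add: subdivision5_def)
qed

section \<open>Properties of the host graph\<close>

text \<open>A graph with a colouring of its half-edges by \<open>2, \<dots>, n\<close> as constructed above.\<close>
locale coloured_graph = pair_graph X for X :: "'a pair_pre_digraph" +
  fixes col :: "'a \<times> 'a \<Rightarrow> nat" and n :: nat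
  assumes col_range: "(u, v) \<in> parcs X \<Longrightarrow> col (u, v) \<in> {2..n}"
    and col_opposite: "(u, v) \<in> parcs X \<Longrightarrow> col (u, v) \<noteq> col (v, u)"
    and col_star: "(u, v) \<in> parcs X \<Longrightarrow> (u, w) \<in> parcs X \<Longrightarrow> col (u, v) = col (u, w) \<Longrightarrow> v = w"
begin

abbreviation H where "H \<equiv> cover_tree X col"

lemma two_level_tree_cover:
  "two_level_tree (Centre i) (children X col i) (leaf_arcs X col i)"
proof
  have fin: "finite {f u v | u v. (u, v) \<in> parcs X \<and> P u v}" for f :: "'a \<Rightarrow> 'a \<Rightarrow> 'b" and P
    by (rule finite_surj[OF pair_finite_arcs, of _ "\<lambda>(u, v). f u v"]) auto
  show "finite (children X col i)"
    using fin[of Quarter] pair_finite_verts by (simp add: children_def)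
  show "finite (leaf_arcs X col i)"
    using fin[of "\<lambda>u v. (Old u, Near u v)" "\<lambda>_ _. True"] fin[of "\<lambda>u v. (Quarter u v, Near u v)"]
      fin[of "\<lambda>u v. (Quarter u v, Mid {u, v})"]
    by (simp add: leaf_arcs_def)
  fix x x' y assume "(x, y) \<in> leaf_arcs X col i" "(x', y) \<in> leaf_arcs X col i"
  then show "x = x'"
    using col_opposite by (auto simp: leaf_arcs_def doubleton_eq_iff split: if_splits)
qed (auto simp: children_def leaf_arcs_def split: if_splits dest: in_arcsD1)

lemma undirected_tree_H: "undirected_tree (H i)"
  unfolding cover_tree_def by (rule two_level_tree.undirected_tree_T[OF two_level_tree_cover])

abbreviation G where "G \<equiv> host X col {1..n}"

lemma subgraph_H_G: "pverts (H i) \<subseteq> pverts G" "parcs (H i) \<subseteq> parcs G" if "i \<in> {1..n}"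
  using that by (auto simp: host_def)

lemma pair_graph_G: "pair_graph G"
proof -
  have pg: "pair_graph (H i)" for i using undirected_tree_H by (simp add: undirected_tree_def)
  show ?thesis
  proof
    fix a assume "a \<in> parcs G"
    then obtain i where i: "i \<in> {1..n}" "a \<in> parcs (H i)" by (auto simp: host_def)
    interpret Hi: pair_graph "H i" by (rule pg)
    show "fst a \<in> pverts G" "snd a \<in> pverts G" "fst a \<noteq> snd a"
      using i Hi.arc_fst_in_verts Hi.arc_snd_in_verts Hi.pair_no_loops subgraph_H_G(1)[of i] by auto
  next
    show "finite (pverts G)" "finite (parcs G)"
      using pg[THEN pair_graph.axioms(1), THEN pair_digraph.axioms(1)]
      by (auto simp: host_def pair_fin_digraph.pair_finite_verts pair_fin_digraph.pair_finite_arcs)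
    have "(b, a) \<in> parcs (H i)" if "(a, b) \<in> parcs (H i)" for a b i
    proof -
      interpret Hi: pair_graph "H i" by (rule pg)
      show ?thesis using that by (rule Hi.arcs_symmetric)
    qed
    then show "symmetric (with_proj G)"
      by (auto simp: symmetric_def sym_def host_def)
  qed
qed

text \<open>
  A retraction onto the tree with index 1. The vertex \<open>Quarter u v\<close>, whose neighbour \<open>Near u v\<close> is a
  leaf of the tree, follows that leaf to its parent \<open>Old u\<close>; everything else outside the tree goes
  to the root.
\<close>
fun fold_star :: "'a gvert \<Rightarrow> 'a gvert" where
  "fold_star (Old u) = Old u"
| "fold_star (Near u v) = Near u v"
| "fold_star (Quarter u v) = Old u"
| "fold_star (Child j b) = (if j = 1 then Child 1 b else Centre 1)"
| "fold_star (Leaf j b) = (if j = 1 then Leaf 1 b else Centre 1)"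
| "fold_star _ = Centre 1"

text \<open>
  A retraction onto the tree with index \<open>i \<noteq> 1\<close>. A vertex outside the tree that has a neighbour among
  the leaves of the tree, which is \<open>Old u\<close> or \<open>Quarter u v\<close>, must follow that leaf to its parent.
  The colouring makes the leaf unique: only one half-edge at \<open>u\<close> has colour \<open>i\<close>, and if \<open>(v, u)\<close>
  has colour \<open>i\<close>, then \<open>(u, v)\<close> has not. Everything else outside the tree goes to the root.
\<close>
fun fold_colour :: "nat \<Rightarrow> 'a gvert \<Rightarrow> 'a gvert" where
  "fold_colour i (Old u) = (if \<exists>v. (u, v) \<in> parcs X \<and> col (u, v) = i
     then Quarter u (THE v. (u, v) \<in> parcs X \<and> col (u, v) = i) else Centre i)"
| "fold_colour i (Near u v) = (if col (u, v) = i then Near u v else Centre i)"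
| "fold_colour i (Quarter u v) = (if col (u, v) = i then Quarter u v
     else if col (v, u) = i then Quarter v u else Centre i)"
| "fold_colour i (Mid e) = (if \<exists>u v. e = {u, v} \<and> (u, v) \<in> parcs X \<and> col (u, v) = i
     then Mid e else Centre i)"
| "fold_colour i (Child j b) = (if j = i then Child i b else Centre i)"
| "fold_colour i (Leaf j b) = (if j = i then Leaf i b else Centre i)"
| "fold_colour i (Centre j) = Centre i"

lemma fold_colour_Old:
  assumes "(u, v) \<in> parcs X" "col (u, v) = i"
  shows "fold_colour i (Old u) = Quarter u v"
proof -
  have "(THE v. (u, v) \<in> parcs X \<and> col (u, v) = i) = v"
    using assms col_star by (intro the_equality) auto
  then show ?thesis using assms by auto
qed

lemma fold_colour_Mid:
  assumes "(u, v) \<in> parcs X"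
  shows "fold_colour i (Mid {u, v}) =
    (if col (u, v) = i \<or> col (v, u) = i then Mid {u, v} else Centre i)"
  using assms arcs_symmetric[OF assms] by (auto simp: doubleton_eq_iff)

text \<open>The arcs of the tree with index \<open>i\<close> that lead away from its root.\<close>
definition down :: "nat \<Rightarrow> 'a gvert rel" where
  "down i = {Centre i} \<times> children X col i \<union> leaf_arcs X col i"

lemma arcs_H: "parcs (H i) = down i \<union> (down i)\<inverse>"
  by (simp add: cover_tree_def two_level_def down_def)

lemma down_cases:
  assumes "(x, y) \<in> down j"
  obtains b where "x = Centre j" "y = Child j b" | b where "x = Child j b" "y = Leaf j b"
  | u where "j = 1" "u \<in> pverts X" "x = Centre 1" "y = Old u"
  | u v where "j = 1" "(u, v) \<in> parcs X" "x = Old u" "y = Near u v"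
  | u v where "(u, v) \<in> parcs X" "col (u, v) = j" "x = Centre j" "y = Quarter u v"
  | u v where "(u, v) \<in> parcs X" "col (u, v) = j" "x = Quarter u v" "y = Near u v"
  | u v where "(u, v) \<in> parcs X" "col (u, v) = j" "x = Quarter u v" "y = Mid {u, v}"
  using assms by (auto simp: down_def children_def leaf_arcs_def split: if_splits)

lemma downI:
  "(Centre j, Child j b) \<in> down j"
  "(Child j b, Leaf j b) \<in> down j"
  "u \<in> pverts X \<Longrightarrow> (Centre 1, Old u) \<in> down 1"
  "(u, v) \<in> parcs X \<Longrightarrow> (Old u, Near u v) \<in> down 1"
  "(u, v) \<in> parcs X \<Longrightarrow> col (u, v) = j \<Longrightarrow> (Centre j, Quarter u v) \<in> down j"
  "(u, v) \<in> parcs X \<Longrightarrow> col (u, v) = j \<Longrightarrow> (Quarter u v, Near u v) \<in> down j"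
  "(u, v) \<in> parcs X \<Longrightarrow> col (u, v) = j \<Longrightarrow> (Quarter u v, Mid {u, v}) \<in> down j"
  using col_range[of u v] by (auto simp: down_def children_def leaf_arcs_def)

lemma retract_arcs:
  assumes down: "\<And>j x y. (x, y) \<in> down j \<Longrightarrow> \<rho> x = \<rho> y \<or> (\<rho> x, \<rho> y) \<in> parcs (H i)"
    and "(x, y) \<in> parcs G"
  shows "\<rho> x = \<rho> y \<or> (\<rho> x, \<rho> y) \<in> parcs (H i)"
proof -
  obtain j where "(x, y) \<in> down j \<or> (y, x) \<in> down j"
    using assms(2) by (auto simp: host_def arcs_H)
  then show ?thesis
  proof
    assume "(y, x) \<in> down j"
    from down[OF this] show ?thesis by (auto simp: arcs_H)
  qed (rule down)
qed

lemma fold_star_down: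
  assumes "(x, y) \<in> down j"
  shows "fold_star x = fold_star y \<or> (fold_star x, fold_star y) \<in> parcs (H 1)"
  using assms
  by (cases rule: down_cases) (auto simp: arcs_H intro: downI in_arcsD1)

lemma fold_colour_down:
  assumes "(x, y) \<in> down j"
  shows "fold_colour i x = fold_colour i y \<or> (fold_colour i x, fold_colour i y) \<in> parcs (H i)"
  using assms
proof (cases rule: down_cases)
  case (3 u)
  then show ?thesis
  proof (cases "\<exists>v. (u, v) \<in> parcs X \<and> col (u, v) = i")
    case True
    then obtain v where "(u, v) \<in> parcs X" "col (u, v) = i" by blast
    then show ?thesis using 3 by (simp add: fold_colour_Old arcs_H downI del: fold_colour.simps(1))
  qed auto
next
  case (4 u v)
  show ?thesis
  proof (cases "\<exists>w. (u, w) \<in> parcs X \<and> col (u, w) = i")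
    case True
    then obtain w where w: "(u, w) \<in> parcs X" "col (u, w) = i" by blast
    then have "col (u, v) = i \<Longrightarrow> v = w" using col_star 4 by metis
    then show ?thesis
      using 4 w by (auto simp: fold_colour_Old arcs_H downI simp del: fold_colour.simps(1))
  next
    case False
    then show ?thesis using 4 by auto
  qed
next
  case (5 u v)
  then show ?thesis by (auto simp: arcs_H downI arcs_symmetric)
next
  case (6 u v)
  then show ?thesis by (auto simp: arcs_H downI arcs_symmetric)
next
  case (7 u v)
  then show ?thesis
    using downI(7)[OF arcs_symmetric[of u v]]
    by (auto simp: fold_colour_Mid arcs_H downI insert_commute simp del: fold_colour.simps(4))
qed (auto simp: arcs_H downI)

lemma retraction:
  assumes i: "i \<in> {1..n}"
  obtains \<rho> where "\<And>x. x \<in> pverts (H i) \<Longrightarrow> \<rho> x = x"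
    and "\<And>x y. (x, y) \<in> parcs G \<Longrightarrow> \<rho> x = \<rho> y \<or> (\<rho> x, \<rho> y) \<in> parcs (H i)"
proof (cases "i = 1")
  case True
  show ?thesis
  proof (rule that)
    show "fold_star x = x" if "x \<in> pverts (H i)" for x
      using that True by (auto simp: cover_tree_def two_level_def children_def leaf_arcs_def)
  qed (use retract_arcs fold_star_down True in blast)
next
  case False
  show ?thesis
  proof (rule that)
    show "fold_colour i x = x" if "x \<in> pverts (H i)" for x
      using that False
      by (auto simp: cover_tree_def two_level_def children_def leaf_arcs_def fold_colour_Mid
        simp del: fold_colour.simps(4))
  qed (use retract_arcs fold_colour_down in blast)
qed

lemma arcs_G: "parcs G = (\<Union>j\<in>{1..n}. down j \<union> (down j)\<inverse>)"
  by (simp add: host_def arcs_H)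

lemma Old_in_G:
  "Old u \<in> pverts G" if "u \<in> pverts X" "1 \<le> n"
  using that by (auto simp: host_def cover_tree_def two_level_def children_def)

lemma induced_subdivision:
  assumes n: "1 \<le> n"
  shows "induced_subgraph (with_proj (subdivision5 X)) (with_proj G)"
proof -
  interpret G: pair_graph G by (rule pair_graph_G)
  let ?Y = "subdivision5 X"
  have arcs_Y: "parcs ?Y = (\<Union>(u, v)\<in>parcs X.
      {(Old u, Near u v), (Near u v, Quarter u v), (Quarter u v, Mid {u, v}),
       (Mid {u, v}, Quarter v u), (Quarter v u, Near v u), (Near v u, Old v)})"
    by (simp add: subdivision5_def)
  have half_path_Y: "{(Old u, Near u v), (Near u v, Quarter u v), (Quarter u v, Mid {u, v})} \<subseteq> parcs ?Y"
      "{(Near u v, Old u), (Quarter u v, Near u v), (Mid {u, v}, Quarter u v)} \<subseteq> parcs ?Y"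
    if uv: "(u, v) \<in> parcs X" for u v
  proof -
    show "{(Old u, Near u v), (Near u v, Quarter u v), (Quarter u v, Mid {u, v})} \<subseteq> parcs ?Y"
      unfolding arcs_Y by (rule subsetI, rule UN_I[OF uv]) auto
    show "{(Near u v, Old u), (Quarter u v, Near u v), (Mid {u, v}, Quarter u v)} \<subseteq> parcs ?Y"
      unfolding arcs_Y
      by (rule subsetI, rule UN_I[OF arcs_symmetric[OF uv]]) (auto simp: insert_commute)
  qed
  have half_path_G: "{(Old u, Near u v), (Near u v, Quarter u v), (Quarter u v, Mid {u, v}),
      (Near u v, Old u), (Quarter u v, Near u v), (Mid {u, v}, Quarter u v)} \<subseteq> parcs G"
    if uv: "(u, v) \<in> parcs X" for u v
    using downI(4)[OF uv] downI(6,7)[OF uv refl] n col_range[OF uv]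
    by (force simp: arcs_G)
  have "parcs ?Y \<subseteq> parcs G"
  proof
    fix a assume "a \<in> parcs ?Y"
    then obtain u v where uv: "(u, v) \<in> parcs X" and
      "a \<in> {(Old u, Near u v), (Near u v, Quarter u v), (Quarter u v, Mid {u, v}),
       (Mid {u, v}, Quarter v u), (Quarter v u, Near v u), (Near v u, Old v)}"
      unfolding arcs_Y by blast
    moreover have "Mid {u, v} = Mid {v, u}" by (simp add: insert_commute)
    ultimately show "a \<in> parcs G"
      using half_path_G[OF uv] half_path_G[OF arcs_symmetric[OF uv]] by auto
  qed
  moreover have "pverts ?Y \<subseteq> pverts G"
  proof -
    have half: "Near u v \<in> pverts G" "Quarter u v \<in> pverts G" "Mid {u, v} \<in> pverts G"
      if "(u, v) \<in> parcs X" for u v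
      using half_path_G[OF that] by (auto dest: G.in_arcsD1 G.in_arcsD2)
    show ?thesis
      using half half[OF arcs_symmetric] Old_in_G n by (auto simp: subdivision5_def)
  qed
  moreover have "(x, y) \<in> parcs ?Y"
    if xy: "(x, y) \<in> parcs G" "x \<in> pverts ?Y" "y \<in> pverts ?Y" for x y
  proof -
    have down: "(a, b) \<in> parcs ?Y \<and> (b, a) \<in> parcs ?Y"
      if "(a, b) \<in> down j" "a \<in> pverts ?Y" "b \<in> pverts ?Y" for a b j
      using that(1)
    proof (cases rule: down_cases)
      case (4 u v)
      then show ?thesis using half_path_Y[of u v] by simp
    next
      case (6 u v)
      then show ?thesis using half_path_Y[of u v] by simp
    next
      case (7 u v)
      then show ?thesis using half_path_Y[of u v] by simp
    qed (use that(2,3) in \<open>auto simp: subdivision5_def\<close>)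
    obtain j where "(x, y) \<in> down j \<or> (y, x) \<in> down j"
      using xy(1) by (auto simp: arcs_G)
    then show ?thesis using down xy(2,3) by blast
  qed
  moreover have "fst a \<in> pverts ?Y \<and> snd a \<in> pverts ?Y" if a: "a \<in> parcs ?Y" for a
  proof -
    obtain u v where uv: "(u, v) \<in> parcs X" and
      a: "a \<in> {(Old u, Near u v), (Near u v, Quarter u v), (Quarter u v, Mid {u, v}),
       (Mid {u, v}, Quarter v u), (Quarter v u, Near v u), (Near v u, Old v)}"
      using a unfolding arcs_Y by blast
    have "{Near u v, Quarter u v, Mid {u, v}, Quarter v u, Near v u} \<subseteq> pverts ?Y"
      unfolding subdivision5_def using uv by fastforce
    moreover have "Old u \<in> pverts ?Y" "Old v \<in> pverts ?Y"
      using uv by (auto simp: subdivision5_def dest: in_arcsD1 in_arcsD2)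
    ultimately show ?thesis using a by auto
  qed
  ultimately have verts: "pverts ?Y \<subseteq> pverts G"
    and arcs: "parcs ?Y = {a \<in> parcs G. fst a \<in> pverts ?Y \<and> snd a \<in> pverts ?Y}"
    by auto
  have "wf_digraph (with_proj ?Y)"
    unfolding wf_digraph_wp_iff by unfold_locales (simp_all add: arcs)
  then have "subgraph (with_proj ?Y) (with_proj G)"
    using verts arcs by (intro subgraphI G.wf_digraph_axioms) (auto simp: compatible_def)
  then show ?thesis using arcs by (intro induced_subgraphI) simp_all
qed

end

theorem theorem2:
  fixes X :: "'a pair_pre_digraph" and \<Delta> :: nat
  assumes "pair_graph X"
    and "Digraph_Component.connected (with_proj X)"
    and "max_degree X = \<Delta>"
  shows "\<exists>(H :: nat \<Rightarrow> nat pair_pre_digraph) (G :: nat pair_pre_digraph).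
           (\<forall>i \<in> {1..\<Delta> + 2}. undirected_tree (H i) \<and> radius (H i) = 2) \<and>
           pair_graph G \<and>
           (\<exists>Y. c_subdivision 5 X Y \<and> induced_subgraph (with_proj Y) (with_proj G)) \<and>
           (\<forall>i \<in> {1..\<Delta> + 2}. isometric_subgraph (H i) G) \<and>
           edge_covers (H ` {1..\<Delta> + 2}) G"
proof -
  interpret pair_graph X by fact
  have "card {a \<in> parcs X. fst a = u} \<le> \<Delta>" if "u \<in> pverts X" for u
    using that assms(3) pair_finite_verts
    by (auto simp: max_degree_def out_degree_def out_arcs_def)
  then obtain col where "coloured_graph X col (\<Delta> + 2)"
    using half_edge_colouring[of \<Delta>]
    by (metis (no_types, lifting) assms(1) coloured_graph.intro coloured_graph_axioms.intro)
  then interpret C: coloured_graph X col "\<Delta> + 2" .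
  interpret G0: pair_graph C.G by (rule C.pair_graph_G)
  (* an encoding of the finitely many vertices by natural numbers *)
  obtain e :: "'a gvert \<Rightarrow> nat" where inj: "inj_on e (pverts C.G)"
    using finite_imp_inj_to_nat_seg[OF G0.pair_finite_verts] by blast
  let ?H = "\<lambda>i. relabel e (C.H i)" and ?G = "relabel e C.G"
  have pg: "pair_graph ?G" using inj C.pair_graph_G by (rule pair_graph_relabel[rotated])
  interpret G: pair_graph ?G by (rule pg)
  have tree: "undirected_tree (?H i) \<and> radius (?H i) = 2" if i: "i \<in> {1..\<Delta> + 2}" for i
  proof -
    have inj_H: "inj_on e (pverts (C.H i))" using inj C.subgraph_H_G(1)[OF i] by (rule inj_on_subset)
    let ?M = "e ` children X col i" and ?E = "map_prod e e ` leaf_arcs X col i"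
    interpret T: two_level_tree "e (Centre i)" ?M ?E
      using two_level_tree.two_level_tree_relabel[OF C.two_level_tree_cover] inj_H
      by (simp add: cover_tree_def)
    have leaf: "(e (Child i b), e (Leaf i b)) \<in> ?E" for b
      by (auto simp: leaf_arcs_def intro!: map_prod_imageI)
    have "e (Child i True) \<noteq> e (Child i False)"
    proof -
      have "Child i b \<in> pverts (C.H i)" for b
        by (simp add: cover_tree_def two_level_def children_def)
      then show ?thesis using inj_onD[OF inj_H, of "Child i True" "Child i False"] by auto
    qed
    then have "radius T.T = 2" by (rule T.radius_T[OF leaf leaf])
    then show ?thesis using T.undirected_tree_T by (simp add: cover_tree_def relabel_two_level)
  qed
  have sub: "subgraph (with_proj (?H i)) (with_proj ?G)" if i: "i \<in> {1..\<Delta> + 2}" for i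
  proof -
    interpret Hi: pair_graph "?H i" using tree[OF i] by (simp add: undirected_tree_def)
    show ?thesis
      using C.subgraph_H_G[OF i]
      by (intro subgraphI Hi.wf_digraph_axioms G.wf_digraph_axioms) (auto simp: compatible_def)
  qed
  have isometric: "isometric_subgraph (?H i) ?G" if i: "i \<in> {1..\<Delta> + 2}" for i
  proof -
    obtain \<rho> where "\<And>x. x \<in> pverts (C.H i) \<Longrightarrow> \<rho> x = x"
      "\<And>x y. (x, y) \<in> parcs C.G \<Longrightarrow> \<rho> x = \<rho> y \<or> (\<rho> x, \<rho> y) \<in> parcs (C.H i)"
      using C.retraction[OF i] by blast
    then obtain \<rho>' where "\<And>x. x \<in> pverts (?H i) \<Longrightarrow> \<rho>' x = x"
      "\<And>x y. (x, y) \<in> parcs ?G \<Longrightarrow> \<rho>' x = \<rho>' y \<or> (\<rho>' x, \<rho>' y) \<in> parcs (?H i)"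
      using relabel_retraction[OF inj G0.pair_wf_digraph C.subgraph_H_G(1)[OF i]] by blast
    moreover have "Digraph_Component.connected (with_proj (?H i))"
      using tree[OF i] by (simp add: undirected_tree_def)
    ultimately show ?thesis using sub[OF i] by (blast intro: isometric_subgraph_retract)
  qed
  have covers: "edge_covers (?H ` {1..\<Delta> + 2}) ?G"
    unfolding edge_covers_def
  proof
    show "\<forall>K\<in>?H ` {1..\<Delta> + 2}. subgraph (with_proj K) (with_proj ?G)" using sub by blast
    show "parcs ?G = (\<Union>K\<in>?H ` {1..\<Delta> + 2}. parcs K)" by (simp add: host_def image_UN)
  qed
  have induced: "induced_subgraph (with_proj (subdivision5 X)) (with_proj C.G)"
    by (rule C.induced_subdivision) simp
  then have induced_relabel: "induced_subgraph (with_proj (relabel e (subdivision5 X))) (with_proj ?G)"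
    by (rule induced_subgraph_relabel[OF inj _ G.pair_wf_digraph])
  have "pverts (subdivision5 X) \<subseteq> pverts C.G"
    using induced by (auto simp: induced_subgraph_def subgraph_def)
  then have subdivision: "c_subdivision 5 X (relabel e (subdivision5 X))"
    by (intro c_subdivision_relabel c_subdivision_subdivision5 inj_on_subset[OF inj])
  show ?thesis
  proof (rule exI[of _ ?H], rule exI[of _ ?G], intro conjI ballI)
    show "undirected_tree (?H i)" "radius (?H i) = 2" "isometric_subgraph (?H i) ?G"
      if "i \<in> {1..\<Delta> + 2}" for i
      using tree[OF that] isometric[OF that] by simp_all
    show "\<exists>Y. c_subdivision 5 X Y \<and> induced_subgraph (with_proj Y) (with_proj ?G)"
      using subdivision induced_relabel by blast
  qed (rule pg covers)+
qed

end
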